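(* Let $A$ be an $(\operatorname{Re}A)$-algebra with unit having a finite basis $e_0=1,e_1,\dots,e_n$ over its scalar algebra $\operatorname{Re}A$, and let $C^p_{kl}\in\operatorname{Re}A$ be its structural constants, $e_ke_l=\sum_{p=0}^nC^p_{kl}e_p$. Then $A$ is an algebra with conjugation, i.e. the mapping $d^*=\operatorname{Re}d-\operatorname{Im}d$ satisfies $(cd)^*=d^*c^*$ for all $c,d\in A$, if $$C^0_{kl}=C^0_{lk},\qquad C^p_{kl}=-C^p_{lk}$$ for all $1\le k\le n$, $1\le l\le n$, $1\le p\le n$.
   Context: Let $D$ be a commutative ring, let $A$ be a $D$-algebra (a $D$-module with a $D$-bilinear product, not assumed associative or commutative) with unit $1$, $A\neq D$, where $D$ is identified with $D\,1\subseteq A$. Let $F$ be a subalgebra of $A$ with $F\neq A$, $D\subseteq F\subseteq Z(A)$, such that $A$ is a free $F$-module with finite basis $e_0,e_1,\dots,e_n$, $e_0=1$. Here the center $Z(A)$ is the set of elements that commute with all elements of $A$ and whose associators (in every position) with all pairs of elements of $A$ vanish. For $d=\sum_i d^ie_i$ ($d^i\in F$) put $\operatorname{Re}d=d^0$, $\operatorname{Im}d=d-d^0$; $\operatorname{Re}A=\{d:\operatorname{Re}d=d\}=F$ is the scalar algebra of $A$. The mapping $d\mapsto d^*=\operatorname{Re}d-\operatorname{Im}d$ is called conjugation provided that $(cd)^*=d^*c^*$ for all $c,d\in A$, and $A$ is then called an algebra with conjugation. *)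

theory Defs
  imports Main "HOL.Modules"
begin

text \<open>The product of a nonassociative algebra is an explicit parameter, because the library's
  classes and locales for algebras include associativity.\<close>

locale nonassoc_algebra = module scale
  for scale :: "'d::comm_ring_1 \<Rightarrow> 'a::ab_group_add \<Rightarrow> 'a" +
  fixes prd :: "'a \<Rightarrow> 'a \<Rightarrow> 'a"  (infixl \<open>\<cdot>\<close> 70)
    and one :: 'a  (\<open>\<one>\<close>)
  assumes linear_right: "module_hom scale scale (\<lambda>b. a \<cdot> b)"
    and linear_left: "module_hom scale scale (\<lambda>a. a \<cdot> b)"
    and unit_left: "\<one> \<cdot> a = a"
    and unit_right: "a \<cdot> \<one> = a"
begin

definition associator :: "'a \<Rightarrow> 'a \<Rightarrow> 'a \<Rightarrow> 'a" where
  "associator a b c = (a \<cdot> b) \<cdot> c - a \<cdot> (b \<cdot> c)"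

definition center :: "'a set" where
  "center = {z. (\<forall>a. z \<cdot> a = a \<cdot> z) \<and>
     (\<forall>a b. associator z a b = 0 \<and> associator a z b = 0 \<and> associator a b z = 0)}"

text \<open>The image of the base ring, i.e. \<open>D\<close> regarded as a subset of the algebra.\<close>

definition base :: "'a set" where
  "base = range (\<lambda>d. scale d \<one>)"

definition subalgebra :: "'a set \<Rightarrow> bool" where
  "subalgebra S \<longleftrightarrow> subspace S \<and> \<one> \<in> S \<and> (\<forall>a\<in>S. \<forall>b\<in>S. a \<cdot> b \<in> S)"

text \<open>Scalars from a subset \<open>F\<close> of the algebra act through the algebra product. For a
  subalgebra \<open>F\<close> of the center, this makes the algebra an \<open>F\<close>-module, and the predicate below
  says that \<open>e 0, \<dots>, e n\<close> is a basis of that module.\<close>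

definition free_basis :: "'a set \<Rightarrow> (nat \<Rightarrow> 'a) \<Rightarrow> nat \<Rightarrow> bool" where
  "free_basis F e n \<longleftrightarrow>
     (\<forall>d. \<exists>x. (\<forall>i\<le>n. x i \<in> F) \<and> d = (\<Sum>i\<le>n. x i \<cdot> e i)) \<and>
     (\<forall>x. (\<forall>i\<le>n. x i \<in> F) \<and> (\<Sum>i\<le>n. x i \<cdot> e i) = 0 \<longrightarrow> (\<forall>i\<le>n. x i = 0))"

end

locale algebra_with_scalars = nonassoc_algebra scale prd one
  for scale :: "'d::comm_ring_1 \<Rightarrow> 'a::ab_group_add \<Rightarrow> 'a"
    and prd :: "'a \<Rightarrow> 'a \<Rightarrow> 'a"  (infixl \<open>\<cdot>\<close> 70)
    and one :: 'a  (\<open>\<one>\<close>) +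
  fixes F :: "'a set" and e :: "nat \<Rightarrow> 'a" and n :: nat
  assumes base_proper: "base \<noteq> UNIV"
    and F_subalgebra: "subalgebra F"
    and F_proper: "F \<noteq> UNIV"
    and base_subset_F: "base \<subseteq> F"
    and F_subset_center: "F \<subseteq> center"
    and basis: "free_basis F e n"
    and e_0: "e 0 = \<one>"
begin

definition coord :: "nat \<Rightarrow> 'a \<Rightarrow> 'a" where
  "coord j d = (THE y. \<exists>x. (\<forall>i\<le>n. x i \<in> F) \<and> d = (\<Sum>i\<le>n. x i \<cdot> e i) \<and> y = x j)"

definition re_part :: "'a \<Rightarrow> 'a" where
  "re_part d = coord 0 d"

definition im_part :: "'a \<Rightarrow> 'a" where
  "im_part d = d - re_part d"

definition scalar_algebra :: "'a set" where
  "scalar_algebra = {d. re_part d = d}"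

definition star :: "'a \<Rightarrow> 'a" where
  "star d = re_part d - im_part d"

definition is_algebra_with_conjugation :: bool where
  "is_algebra_with_conjugation \<longleftrightarrow> (\<forall>c d. star (c \<cdot> d) = star d \<cdot> star c)"

lemma coord_expansion:
  assumes x: "\<forall>i\<le>n. x i \<in> F" and j: "j \<le> n"
  shows "coord j (\<Sum>i\<le>n. x i \<cdot> e i) = x j"
  unfolding coord_def
proof (rule the_equality)
  show "\<exists>x'. (\<forall>i\<le>n. x' i \<in> F) \<and> (\<Sum>i\<le>n. x i \<cdot> e i) = (\<Sum>i\<le>n. x' i \<cdot> e i) \<and> x j = x' j"
    using x by blast
next
  fix y
  assume "\<exists>x'. (\<forall>i\<le>n. x' i \<in> F) \<and> (\<Sum>i\<le>n. x i \<cdot> e i) = (\<Sum>i\<le>n. x' i \<cdot> e i) \<and> y = x' j"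
  then obtain x' where x': "\<forall>i\<le>n. x' i \<in> F"
      and eq: "(\<Sum>i\<le>n. x i \<cdot> e i) = (\<Sum>i\<le>n. x' i \<cdot> e i)" and y: "y = x' j"
    by blast
  have sub: "subspace F"
    using F_subalgebra by (simp add: subalgebra_def)
  have "(\<Sum>i\<le>n. (x' i - x i) \<cdot> e i) = (\<Sum>i\<le>n. x' i \<cdot> e i - x i \<cdot> e i)"
    using module_hom.diff[OF linear_left] by simp
  also have "\<dots> = 0"
    using eq by (simp add: sum_subtractf)
  finally have "\<forall>i\<le>n. x' i - x i = 0"
    using basis x x' subspace_diff[OF sub]
    unfolding free_basis_def by (elim conjE allE[of _ "\<lambda>i. x' i - x i"]) blast
  then show "y = x j"
    using j y by simp
qed

lemma scalar_algebra_eq: "scalar_algebra = F"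
proof (intro set_eqI iffI)
  fix d assume "d \<in> scalar_algebra"
  moreover obtain x where x: "\<forall>i\<le>n. x i \<in> F" "d = (\<Sum>i\<le>n. x i \<cdot> e i)"
    using basis unfolding free_basis_def by blast
  ultimately show "d \<in> F"
    using coord_expansion[of x 0]
    by (metis (mono_tags, lifting) le0 mem_Collect_eq scalar_algebra_def re_part_def)
next
  fix d assume d: "d \<in> F"
  define x where "x = (\<lambda>i::nat. if i = 0 then d else 0)"
  have x: "\<forall>i\<le>n. x i \<in> F"
    using d F_subalgebra by (auto simp: x_def subalgebra_def subspace_def)
  have "(\<Sum>i\<le>n. x i \<cdot> e i) = (\<Sum>i\<le>n. if i = 0 then d else 0)"
    using module_hom.zero[OF linear_left] by (intro sum.cong) (auto simp: x_def e_0 unit_right)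
  then have "(\<Sum>i\<le>n. x i \<cdot> e i) = d"
    by simp
  then show "d \<in> scalar_algebra"
    using coord_expansion[OF x, of 0] by (simp add: scalar_algebra_def re_part_def x_def)
qed

end

end

theory Submission
  imports Defs
begin

text \<open>Conjugation is linear over \<open>F\<close>, fixes \<open>e 0\<close> and negates the other basis elements, so the
  hypotheses on the structural constants say that it reverses products of basis elements. As \<open>F\<close>
  lies in the center, the scalars can be collected in front of a product, and reversal extends
  bilinearly to the whole algebra.\<close>

context nonassoc_algebra
begin

lemma prd_add_left: "(a + b) \<cdot> c = a \<cdot> c + b \<cdot> c"
  by (rule module_hom.add[OF linear_left])

lemma prd_diff_right: "a \<cdot> (b - c) = a \<cdot> b - a \<cdot> c"
  by (rule module_hom.diff[OF linear_right])

lemma prd_zero_left: "0 \<cdot> a = 0"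
  by (rule module_hom.zero[OF linear_left])

lemma prd_minus_left: "(- a) \<cdot> b = - (a \<cdot> b)"
  by (rule module_hom.neg[OF linear_left])

lemma prd_minus_right: "a \<cdot> (- b) = - (a \<cdot> b)"
  by (rule module_hom.neg[OF linear_right])

lemma prd_sum_left: "sum f S \<cdot> a = (\<Sum>i\<in>S. f i \<cdot> a)"
  by (rule module_hom.sum[OF linear_left])

lemma prd_sum_right: "a \<cdot> sum f S = (\<Sum>i\<in>S. a \<cdot> f i)"
  by (rule module_hom.sum[OF linear_right])

lemma center_comm: "z \<in> center \<Longrightarrow> z \<cdot> a = a \<cdot> z"
  by (simp add: center_def)

lemma center_assoc:
  assumes "z \<in> center"
  shows "(z \<cdot> a) \<cdot> b = z \<cdot> (a \<cdot> b)" "(a \<cdot> z) \<cdot> b = a \<cdot> (z \<cdot> b)"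
  using assms by (simp_all add: center_def associator_def)

text \<open>Collects two scalars in front of a product without associativity of the algebra: only
  associators with a central entry are rebracketed, first around \<open>y\<close> to bring it past
  \<open>a\<close>, then around \<open>x\<close>.\<close>

lemma center_prd_prd:
  assumes x: "x \<in> center" and y: "y \<in> center"
  shows "(x \<cdot> a) \<cdot> (y \<cdot> b) = (x \<cdot> y) \<cdot> (a \<cdot> b)"
proof -
  have "a \<cdot> (y \<cdot> b) = y \<cdot> (a \<cdot> b)"
    using center_assoc[OF y] center_comm[OF y] by metis
  then show ?thesis
    using center_assoc(1)[OF x] by simp
qed

end

context algebra_with_scalars
begin

lemma F_center: "x \<in> F \<Longrightarrow> x \<in> center"
  using F_subset_center by blast

lemma F_add: "x \<in> F \<Longrightarrow> y \<in> F \<Longrightarrow> x + y \<in> F"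
  using F_subalgebra subspace_add by (auto simp: subalgebra_def)

lemma F_prd: "x \<in> F \<Longrightarrow> y \<in> F \<Longrightarrow> x \<cdot> y \<in> F"
  using F_subalgebra by (auto simp: subalgebra_def)

lemma basis_expansionE:
  obtains x where "\<forall>i\<le>n. x i \<in> F" "d = (\<Sum>i\<le>n. x i \<cdot> e i)"
  using basis unfolding free_basis_def by blast

lemma re_part_expansion: "\<forall>i\<le>n. x i \<in> F \<Longrightarrow> re_part (\<Sum>i\<le>n. x i \<cdot> e i) = x 0"
  by (simp add: re_part_def coord_expansion)

lemma re_part_F: "x \<in> F \<Longrightarrow> re_part x = x"
  using scalar_algebra_eq by (auto simp: scalar_algebra_def)

text \<open>Adding expansions coefficientwise gives an expansion of the sum, and coordinates in the
  basis are unique.\<close>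

lemma re_part_add: "re_part (c + d) = re_part c + re_part d"
proof -
  obtain x where x: "\<forall>i\<le>n. x i \<in> F" "c = (\<Sum>i\<le>n. x i \<cdot> e i)" by (rule basis_expansionE)
  obtain y where y: "\<forall>i\<le>n. y i \<in> F" "d = (\<Sum>i\<le>n. y i \<cdot> e i)" by (rule basis_expansionE)
  have "c + d = (\<Sum>i\<le>n. (x i + y i) \<cdot> e i)"
    by (simp add: x y prd_add_left sum.distrib)
  then have "re_part (c + d) = x 0 + y 0"
    using re_part_expansion[of "\<lambda>i. x i + y i"] x y F_add by simp
  then show ?thesis
    using x y re_part_expansion by simp
qed

text \<open>As \<open>a\<close> is central, it can be absorbed into each coefficient, which stays in
  \<open>F\<close> because \<open>F\<close> is closed under products.\<close>

lemma re_part_prd: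
  assumes a: "a \<in> F"
  shows "re_part (a \<cdot> d) = a \<cdot> re_part d"
proof -
  obtain y where y: "\<forall>i\<le>n. y i \<in> F" "d = (\<Sum>i\<le>n. y i \<cdot> e i)" by (rule basis_expansionE)
  have "a \<cdot> d = (\<Sum>i\<le>n. (a \<cdot> y i) \<cdot> e i)"
    using center_assoc(1)[OF F_center[OF a]] by (simp add: y prd_sum_right)
  then have "re_part (a \<cdot> d) = a \<cdot> y 0"
    using re_part_expansion[of "\<lambda>i. a \<cdot> y i"] y a F_prd by simp
  then show ?thesis
    using y re_part_expansion by simp
qed

lemma star_add: "star (c + d) = star c + star d"
  by (simp add: star_def im_part_def re_part_add)

lemma star_prd: "a \<in> F \<Longrightarrow> star (a \<cdot> d) = a \<cdot> star d"
  by (simp add: star_def im_part_def re_part_prd prd_diff_right)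

lemma star_zero: "star 0 = 0"
  using star_add[of 0 0] by simp

lemma star_sum: "star (sum f S) = (\<Sum>i\<in>S. star (f i))"
  using sum_comp_morphism[of star f S] by (simp add: star_zero star_add o_def)

lemma star_expansion:
  "\<forall>i\<le>n. x i \<in> F \<Longrightarrow> star (\<Sum>i\<le>n. x i \<cdot> e i) = (\<Sum>i\<le>n. x i \<cdot> star (e i))"
  by (simp add: star_sum star_prd)

lemma star_one: "star \<one> = \<one>"
proof -
  have "\<one> \<in> F" using F_subalgebra by (simp add: subalgebra_def)
  then show ?thesis by (simp add: star_def im_part_def re_part_F)
qed

lemma star_basis:
  assumes "1 \<le> i" "i \<le> n"
  shows "star (e i) = - e i"
proof -
  \<comment> \<open>The coefficients of \<open>e i\<close> itself; the one at index 0 vanishes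
    because \<open>i\<close> is at least 1, so \<open>e i\<close> is purely imaginary.\<close>
  define x where "x = (\<lambda>j. if j = i then \<one> else 0)"
  have x: "\<forall>j\<le>n. x j \<in> F"
    using F_subalgebra by (auto simp: x_def subalgebra_def subspace_def)
  have "(\<Sum>j\<le>n. x j \<cdot> e j) = (\<Sum>j\<le>n. if j = i then e i else 0)"
    by (intro sum.cong) (auto simp: x_def unit_left prd_zero_left)
  then have "e i = (\<Sum>j\<le>n. x j \<cdot> e j)"
    using assms by simp
  then have "re_part (e i) = 0"
    using re_part_expansion[OF x] assms by (simp add: x_def)
  then show ?thesis
    by (simp add: star_def im_part_def)
qed

text \<open>Both sides of the conjugation law are additive and \<open>F\<close>-homogeneous in each
  argument, so agreement on pairs of basis elements suffices.\<close>

lemma is_algebra_with_conjugationI: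
  assumes "\<And>k l. k \<le> n \<Longrightarrow> l \<le> n \<Longrightarrow> star (e k \<cdot> e l) = star (e l) \<cdot> star (e k)"
  shows is_algebra_with_conjugation
  unfolding is_algebra_with_conjugation_def
proof (intro allI)
  fix c d
  obtain x where x: "\<forall>i\<le>n. x i \<in> F" "c = (\<Sum>i\<le>n. x i \<cdot> e i)" by (rule basis_expansionE)
  obtain y where y: "\<forall>i\<le>n. y i \<in> F" "d = (\<Sum>i\<le>n. y i \<cdot> e i)" by (rule basis_expansionE)
  have "star (c \<cdot> d) = (\<Sum>j\<le>n. \<Sum>i\<le>n. star ((x i \<cdot> e i) \<cdot> (y j \<cdot> e j)))"
    by (simp add: x y prd_sum_left prd_sum_right star_sum)
  also have "\<dots> = (\<Sum>j\<le>n. \<Sum>i\<le>n. (y j \<cdot> star (e j)) \<cdot> (x i \<cdot> star (e i)))"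
  proof (intro sum.cong refl)
    fix i j assume "j \<in> {..n}" "i \<in> {..n}"
    then have "i \<le> n" "j \<le> n" "x i \<in> F" "y j \<in> F"
      using x y by auto
    then have "star ((x i \<cdot> e i) \<cdot> (y j \<cdot> e j)) = (x i \<cdot> y j) \<cdot> (star (e j) \<cdot> star (e i))"
      using center_prd_prd[OF F_center F_center] star_prd[OF F_prd] assms by metis
    \<comment> \<open>Reversing the factors puts the coefficient of \<open>d\<close> first, so the
      two scalars must be exchanged; they commute because \<open>x i\<close> is central.\<close>
    also have "\<dots> = (y j \<cdot> x i) \<cdot> (star (e j) \<cdot> star (e i))"
      using center_comm[OF F_center[OF \<open>x i \<in> F\<close>], of "y j"] by simp
    also have "\<dots> = (y j \<cdot> star (e j)) \<cdot> (x i \<cdot> star (e i))"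
      using center_prd_prd[OF F_center F_center] \<open>x i \<in> F\<close> \<open>y j \<in> F\<close> by metis
    finally show "star ((x i \<cdot> e i) \<cdot> (y j \<cdot> e j)) = (y j \<cdot> star (e j)) \<cdot> (x i \<cdot> star (e i))" .
  qed
  \<comment> \<open>Expanding the right-hand product leaves the sum over \<open>i\<close> outside,
    hence the interchange of sums.\<close>
  also have "\<dots> = (\<Sum>j\<le>n. y j \<cdot> star (e j)) \<cdot> (\<Sum>i\<le>n. x i \<cdot> star (e i))"
    unfolding prd_sum_left prd_sum_right by (rule sum.swap)
  also have "\<dots> = star d \<cdot> star c"
    using x y star_expansion by simp
  finally show "star (c \<cdot> d) = star d \<cdot> star c" .
qed

text \<open>For positive \<open>k\<close> and \<open>l\<close>, the sign \<open>star\<close> puts on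
  each imaginary basis element is absorbed by antisymmetry of its coefficient, and the real
  coefficient is symmetric; this turns the expansion of \<open>e k \<cdot> e l\<close> into that of
  \<open>e l \<cdot> e k\<close>.\<close>

lemma star_prd_basis:
  assumes C_F: "\<And>p k l. \<lbrakk>p \<le> n; k \<le> n; l \<le> n\<rbrakk> \<Longrightarrow> C p k l \<in> F"
    and C: "\<And>k l. \<lbrakk>k \<le> n; l \<le> n\<rbrakk> \<Longrightarrow> e k \<cdot> e l = (\<Sum>p\<le>n. C p k l \<cdot> e p)"
    and sym: "\<And>k l. \<lbrakk>1 \<le> k; k \<le> n; 1 \<le> l; l \<le> n\<rbrakk> \<Longrightarrow> C 0 k l = C 0 l k"
    and anti: "\<And>k l p. \<lbrakk>1 \<le> k; k \<le> n; 1 \<le> l; l \<le> n; 1 \<le> p; p \<le> n\<rbrakk> \<Longrightarrow> C p k l = - C p l k"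
    and kl: "k \<le> n" "l \<le> n"
  shows "star (e k \<cdot> e l) = star (e l) \<cdot> star (e k)"
\<comment> \<open>\<open>sym\<close> and \<open>anti\<close> speak of positive indices only. At
  index 0 the factor is the unit, which \<open>star\<close> fixes.\<close>
proof (cases "k = 0 \<or> l = 0")
  case True
  then show ?thesis
    by (auto simp: e_0 star_one unit_left unit_right)
next
  case False
  then have pos: "1 \<le> k" "1 \<le> l" by auto
  have "star (e k \<cdot> e l) = (\<Sum>p\<le>n. C p k l \<cdot> star (e p))"
    using C_F kl by (simp add: C star_expansion)
  also have "\<dots> = (\<Sum>p\<le>n. C p l k \<cdot> e p)"
  proof (intro sum.cong refl)
    fix p assume p: "p \<in> {..n}"
    show "C p k l \<cdot> star (e p) = C p l k \<cdot> e p"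
    proof (cases "p = 0")
      case True
      then show ?thesis using sym[OF pos(1) kl(1) pos(2) kl(2)] by (simp add: e_0 star_one)
    next
      case False
      then have "1 \<le> p" "p \<le> n" using p by auto
      then show ?thesis
        using anti[OF pos(1) kl(1) pos(2) kl(2)]
        by (simp add: star_basis prd_minus_left prd_minus_right)
    qed
  qed
  \<comment> \<open>The sum is the expansion of \<open>e l \<cdot> e k\<close>, and the two signs
    from \<open>star (e l)\<close> and \<open>star (e k)\<close> cancel.\<close>
  also have "\<dots> = star (e l) \<cdot> star (e k)"
    using kl pos C by (simp add: star_basis prd_minus_left prd_minus_right)
  finally show ?thesis .
qed

end

theorem theorem4p5:
  fixes scale :: "'d::comm_ring_1 \<Rightarrow> 'a::ab_group_add \<Rightarrow> 'a"
    and prd :: "'a \<Rightarrow> 'a \<Rightarrow> 'a"  (infixl \<open>\<cdot>\<close> 70)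
    and one :: 'a
    and F :: "'a set" and e :: "nat \<Rightarrow> 'a" and n :: nat
    and C :: "nat \<Rightarrow> nat \<Rightarrow> nat \<Rightarrow> 'a"
  assumes "algebra_with_scalars scale prd one F e n"
    and "\<And>p k l. \<lbrakk>p \<le> n; k \<le> n; l \<le> n\<rbrakk> \<Longrightarrow>
           C p k l \<in> algebra_with_scalars.scalar_algebra prd F e n"
    and "\<And>k l. \<lbrakk>k \<le> n; l \<le> n\<rbrakk> \<Longrightarrow> e k \<cdot> e l = (\<Sum>p\<le>n. C p k l \<cdot> e p)"
    and "\<And>k l. \<lbrakk>1 \<le> k; k \<le> n; 1 \<le> l; l \<le> n\<rbrakk> \<Longrightarrow> C 0 k l = C 0 l k"
    and "\<And>k l p. \<lbrakk>1 \<le> k; k \<le> n; 1 \<le> l; l \<le> n; 1 \<le> p; p \<le> n\<rbrakk> \<Longrightarrow> C p k l = - C p l k"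
  shows "algebra_with_scalars.is_algebra_with_conjugation prd F e n"
proof -
  interpret algebra_with_scalars scale prd one F e n
    by fact
  \<comment> \<open>The constants are given in the scalar algebra, which
    \<open>scalar_algebra_eq\<close> identifies with the coefficient ring \<open>F\<close> used by
    the lemmas.\<close>
  show ?thesis
    using assms(2-5) unfolding scalar_algebra_eq
    by (intro is_algebra_with_conjugationI star_prd_basis[of C])
qed

end
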